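(* Let $(G,\tau)$ be a compact abelian group and let $\phi:(G,\tau)\to(G,\tau)$ be a continuous endomorphism. Let $\widehat{\phi}:\widehat{G}\to\widehat{G}$ be the dual endomorphism of the (discrete) Pontryagin dual $\widehat G$ of $(G,\tau)$. Then $$\mathrm{ent}^\star_\tau(\phi)=\mathrm{ent}(\widehat{\phi}).$$
   Context: Compact groups are Hausdorff. For an abelian group $G$, let $\mathcal C(G)$ be the family of all finite-index subgroups of $G$. For an endomorphism $\phi$ of $G$, $N\in\mathcal C(G)$ and an integer $n\ge 1$, let $B_n(\phi,N)=N\cap\phi^{-1}(N)\cap\ldots\cap\phi^{-n+1}(N)$, $C_n(\phi,N)=G/B_n(\phi,N)$ (a finite group), and $H^\star(\phi,N)=\lim_{n\to\infty}\frac{\log|C_n(\phi,N)|}{n}$ (the limit exists and is finite). For a topological abelian group $(G,\tau)$ let $\mathcal C_\tau(G)=\{N\in\mathcal C(G): N \text{ is } \tau\text{-open}\}$. The topological adjoint entropy of a continuous endomorphism $\phi:(G,\tau)\to(G,\tau)$ is $\mathrm{ent}^\star_\tau(\phi)=\sup\{H^\star(\phi,N):N\in\mathcal C_\tau(G)\}\in[0,\infty]$. For an endomorphism $\psi$ of an abelian group $A$ and a finite subgroup $F$ of $A$, let $T_n(\psi,F)=F+\psi(F)+\ldots+\psi^{n-1}(F)$ and $H(\psi,F)=\lim_{n\to\infty}\frac{\log|T_n(\psi,F)|}{n}$. The algebraic entropy of $\psi$ is $\mathrm{ent}(\psi)=\sup\{H(\psi,F): F \text{ a finite subgroup of } A\}$.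 The Pontryagin dual $\widehat G$ of a compact abelian group $(G,\tau)$ is the (discrete) group of all continuous homomorphisms $\chi:(G,\tau)\to\mathbb T=\mathbb R/\mathbb Z$, and $\widehat\phi(\chi)=\chi\circ\phi$. *)

theory Defs
  imports "HOL-Analysis.Analysis" "HOL-Algebra.Elementary_Groups"
begin

section \<open>Compact abelian groups\<close>

text \<open>Abelian groups are written multiplicatively, following \<^locale>\<open>comm_group\<close>.\<close>

locale topological_comm_group = comm_group G for G (structure) +
  fixes \<tau> :: "'a topology"
  assumes topspace_eq: "topspace \<tau> = carrier G"
    and continuous_mult: "continuous_map (prod_topology \<tau> \<tau>) \<tau> (\<lambda>(x, y). x \<otimes> y)"
    and continuous_inv: "continuous_map \<tau> \<tau> (\<lambda>x. inv x)"

locale compact_comm_group = topological_comm_group +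
  assumes compact: "compact_space \<tau>"
    and Hausdorff: "Hausdorff_space \<tau>"

definition continuous_endo :: "('a, 'm) monoid_scheme \<Rightarrow> 'a topology \<Rightarrow> ('a \<Rightarrow> 'a) set" where
  "continuous_endo G \<tau> = {\<phi>. \<phi> \<in> hom G G \<and> continuous_map \<tau> \<tau> \<phi>}"


section \<open>Topological adjoint entropy\<close>

definition finite_index_subgroups :: "('a, 'm) monoid_scheme \<Rightarrow> 'a set set" where
  "finite_index_subgroups G = {N. subgroup N G \<and> finite (rcosets\<^bsub>G\<^esub> N)}"

definition open_finite_index_subgroups ::
    "('a, 'm) monoid_scheme \<Rightarrow> 'a topology \<Rightarrow> 'a set set" where
  "open_finite_index_subgroups G \<tau> = {N \<in> finite_index_subgroups G. openin \<tau> N}"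

definition cotrajectory ::
    "('a, 'm) monoid_scheme \<Rightarrow> ('a \<Rightarrow> 'a) \<Rightarrow> 'a set \<Rightarrow> nat \<Rightarrow> 'a set" where
  "cotrajectory G \<phi> N n = {x \<in> carrier G. \<forall>i<n. (\<phi> ^^ i) x \<in> N}"

definition cotrajectory_quotient ::
    "('a, 'm) monoid_scheme \<Rightarrow> ('a \<Rightarrow> 'a) \<Rightarrow> 'a set \<Rightarrow> nat \<Rightarrow> 'a set monoid" where
  "cotrajectory_quotient G \<phi> N n = G Mod cotrajectory G \<phi> N n"

definition adjoint_entropy_wrt ::
    "('a, 'm) monoid_scheme \<Rightarrow> ('a \<Rightarrow> 'a) \<Rightarrow> 'a set \<Rightarrow> real" where
  "adjoint_entropy_wrt G \<phi> N =
     lim (\<lambda>n. ln (real (order (cotrajectory_quotient G \<phi> N n))) / real n)"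

definition topological_adjoint_entropy ::
    "('a, 'm) monoid_scheme \<Rightarrow> 'a topology \<Rightarrow> ('a \<Rightarrow> 'a) \<Rightarrow> ereal" where
  "topological_adjoint_entropy G \<tau> \<phi> =
     (SUP N \<in> open_finite_index_subgroups G \<tau>. ereal (adjoint_entropy_wrt G \<phi> N))"


section \<open>Algebraic entropy\<close>

primrec trajectory ::
    "('a, 'm) monoid_scheme \<Rightarrow> ('a \<Rightarrow> 'a) \<Rightarrow> 'a set \<Rightarrow> nat \<Rightarrow> 'a set" where
  "trajectory A \<psi> F 0 = {\<one>\<^bsub>A\<^esub>}"
| "trajectory A \<psi> F (Suc n) = trajectory A \<psi> F n <#>\<^bsub>A\<^esub> ((\<psi> ^^ n) ` F)"

definition algebraic_entropy_wrt ::
    "('a, 'm) monoid_scheme \<Rightarrow> ('a \<Rightarrow> 'a) \<Rightarrow> 'a set \<Rightarrow> real" where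
  "algebraic_entropy_wrt A \<psi> F =
     lim (\<lambda>n. ln (real (card (trajectory A \<psi> F n))) / real n)"

definition algebraic_entropy :: "('a, 'm) monoid_scheme \<Rightarrow> ('a \<Rightarrow> 'a) \<Rightarrow> ereal" where
  "algebraic_entropy A \<psi> =
     (SUP F \<in> {F. subgroup F A \<and> finite F}. ereal (algebraic_entropy_wrt A \<psi> F))"


section \<open>The circle group\<close>

definition real_group :: "real monoid" where
  "real_group = \<lparr>carrier = UNIV, mult = (+), one = 0\<rparr>"

definition circle_group :: "real set monoid" where
  "circle_group = real_group Mod \<int>"

definition circle_proj :: "real \<Rightarrow> real set" where
  "circle_proj x = \<int> #>\<^bsub>real_group\<^esub> x"

text \<open>The quotient topology along \<^term>\<open>circle_proj\<close>; see \<open>quotient_map_circle_proj\<close> below.\<close>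

definition circle_topology :: "real set topology" where
  "circle_topology =
     topology (\<lambda>U. U \<subseteq> carrier circle_group \<and> open (circle_proj -` U))"

lemma openin_circle_topology:
  "openin circle_topology U \<longleftrightarrow> U \<subseteq> carrier circle_group \<and> open (circle_proj -` U)"
proof -
  have "istopology (\<lambda>U. U \<subseteq> carrier circle_group \<and> open (circle_proj -` U))"
    unfolding istopology_def by (auto simp: vimage_Union intro: open_Int open_UN)
  then show ?thesis
    unfolding circle_topology_def by simp
qed

lemma comm_group_real_group: "comm_group real_group"
proof (rule comm_groupI)
  fix x assume "x \<in> carrier real_group"
  then show "\<exists>y\<in>carrier real_group. y \<otimes>\<^bsub>real_group\<^esub> x = \<one>\<^bsub>real_group\<^esub>"
    by (auto simp: real_group_def intro: exI[of _ "-x"])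
qed (auto simp: real_group_def)

lemma subgroup_Ints: "subgroup \<int> real_group"
proof -
  interpret comm_group real_group by (rule comm_group_real_group)
  have inv: "inv\<^bsub>real_group\<^esub> x = - x" for x
    by (rule inv_equality) (auto simp: real_group_def)
  show ?thesis
    by unfold_locales (auto simp: inv, auto simp: real_group_def)
qed

lemma comm_group_circle_group: "comm_group circle_group"
  unfolding circle_group_def
  by (rule comm_group.abelian_FactGroup[OF comm_group_real_group subgroup_Ints])

lemma carrier_circle_group: "carrier circle_group = range circle_proj"
  by (auto simp: circle_group_def FactGroup_def RCOSETS_def circle_proj_def real_group_def)

lemma topspace_circle_topology: "topspace circle_topology = carrier circle_group"
proof -
  have "circle_proj -` carrier circle_group = UNIV"
    by (auto simp: carrier_circle_group)
  then have "openin circle_topology (carrier circle_group)"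
    by (simp add: openin_circle_topology)
  then show ?thesis
    by (meson openin_circle_topology openin_subset openin_topspace subset_antisym)
qed

lemma quotient_map_circle_proj: "quotient_map euclideanreal circle_topology circle_proj"
  unfolding quotient_map_def
  by (auto simp: topspace_circle_topology carrier_circle_group openin_circle_topology vimage_def)


section \<open>The Pontryagin dual\<close>

text \<open>Characters are functions on \<^term>\<open>carrier G\<close>; to make equality of characters
  coincide with equality of HOL functions they are taken to be
  \<^const>\<open>undefined\<close> outside \<^term>\<open>carrier G\<close>.\<close>

definition characters :: "('a, 'm) monoid_scheme \<Rightarrow> 'a topology \<Rightarrow> ('a \<Rightarrow> real set) set" where
  "characters G \<tau> =
     {\<xi> \<in> extensional (carrier G).
        \<xi> \<in> hom G circle_group \<and> continuous_map \<tau> circle_topology \<xi>}"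

definition dual_group ::
    "('a, 'm) monoid_scheme \<Rightarrow> 'a topology \<Rightarrow> ('a \<Rightarrow> real set) monoid" where
  "dual_group G \<tau> =
     \<lparr>carrier = characters G \<tau>,
      mult = (\<lambda>\<xi> \<eta>. \<lambda>x\<in>carrier G. \<xi> x \<otimes>\<^bsub>circle_group\<^esub> \<eta> x),
      one = (\<lambda>x\<in>carrier G. \<one>\<^bsub>circle_group\<^esub>)\<rparr>"

definition dual_endo ::
    "('a, 'm) monoid_scheme \<Rightarrow> ('a \<Rightarrow> 'a) \<Rightarrow> ('a \<Rightarrow> real set) \<Rightarrow> ('a \<Rightarrow> real set)" where
  "dual_endo G \<phi> \<xi> = compose (carrier G) \<xi> \<phi>"

lemma open_circle_proj: "open_map euclideanreal circle_topology circle_proj"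
  unfolding open_map_def
proof (intro allI impI)
  fix U :: "real set" assume "openin euclidean U"
  then have U: "open U" by simp
  have proj_eq: "circle_proj x = circle_proj y \<longleftrightarrow> (\<exists>k\<in>\<int>. y = k + x)" for x y
  proof
    assume "circle_proj x = circle_proj y"
    moreover have "0 + y \<in> circle_proj y"
      unfolding circle_proj_def r_coset_def real_group_def by force
    ultimately show "\<exists>k\<in>\<int>. y = k + x"
      by (auto simp: circle_proj_def r_coset_def real_group_def)
  next
    assume "\<exists>k\<in>\<int>. y = k + x"
    then obtain k where k: "k \<in> \<int>" "y = k + x" by blast
    have "\<exists>m\<in>\<int>. l + x = m + y" if "l \<in> \<int>" for l
      using that k by (intro bexI[of _ "l - k"]) auto
    moreover have "\<exists>m\<in>\<int>. l + y = m + x" if "l \<in> \<int>" for l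
      using that k by (intro bexI[of _ "l + k"]) auto
    ultimately show "circle_proj x = circle_proj y"
      by (auto simp: circle_proj_def r_coset_def real_group_def)
  qed
  have "circle_proj -` circle_proj ` U = (\<Union>k\<in>\<int>. (+) k ` U)"
  proof (rule Set.set_eqI, rule iffI)
    fix y assume "y \<in> circle_proj -` circle_proj ` U"
    then obtain x where "x \<in> U" "circle_proj x = circle_proj y"
      by (metis imageE vimageD)
    then show "y \<in> (\<Union>k\<in>\<int>. (+) k ` U)"
      using proj_eq[of x y] by auto
  next
    fix y assume "y \<in> (\<Union>k\<in>\<int>. (+) k ` U)"
    then obtain k x where "k \<in> \<int>" "x \<in> U" "y = k + x"
      by (elim UN_E imageE)
    then have "circle_proj x = circle_proj y"
      using proj_eq[of x y] by (intro iffD2[OF proj_eq] bexI[of _ k])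
    with \<open>x \<in> U\<close> show "y \<in> circle_proj -` circle_proj ` U"
      by (intro vimageI2) (metis imageI)
  qed
  moreover have "open (\<Union>k\<in>\<int>. (+) k ` U)"
    using U by (intro open_UN ballI open_translation)
  ultimately show "openin circle_topology (circle_proj ` U)"
    by (auto simp: openin_circle_topology carrier_circle_group)
qed

lemma circle_proj_add:
  "circle_proj x \<otimes>\<^bsub>circle_group\<^esub> circle_proj y = circle_proj (x + y)"
proof -
  interpret normal \<int> real_group
    by (rule comm_group.subgroup_imp_normal[OF comm_group_real_group subgroup_Ints])
  show ?thesis
    using rcos_sum[of x y]
    by (simp add: circle_group_def FactGroup_def circle_proj_def real_group_def)
qed

lemma continuous_map_circle_mult:
  "continuous_map (prod_topology circle_topology circle_topology) circle_topology
     (\<lambda>(a, b). a \<otimes>\<^bsub>circle_group\<^esub> b)"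
proof -
  let ?q = "\<lambda>(x, y). (circle_proj x, circle_proj y)"
  let ?R = "prod_topology euclideanreal euclideanreal"
  let ?C = "prod_topology circle_topology circle_topology"
  have c: "continuous_map euclideanreal circle_topology circle_proj"
    using quotient_map_circle_proj by (rule quotient_imp_continuous_map)
  have "open_map ?R ?C ?q"
    unfolding open_map_def
  proof (intro allI impI)
    fix U assume U: "openin ?R U"
    show "openin ?C (?q ` U)"
      unfolding openin_prod_topology_alt
    proof (intro allI impI)
      fix a b assume "(a, b) \<in> ?q ` U"
      then obtain x y where xy: "(x, y) \<in> U" "a = circle_proj x" "b = circle_proj y"
        by auto
      have "\<exists>V W. openin euclideanreal V \<and> openin euclideanreal W \<and> x \<in> V \<and> y \<in> W \<and> V \<times> W \<subseteq> U"
        by (rule U[unfolded openin_prod_topology_alt, rule_format, OF xy(1)])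
      then obtain V W where VW: "openin euclideanreal V" "openin euclideanreal W"
          "x \<in> V" "y \<in> W" "V \<times> W \<subseteq> U"
        by metis
      show "\<exists>V' W'. openin circle_topology V' \<and> openin circle_topology W' \<and>
          a \<in> V' \<and> b \<in> W' \<and> V' \<times> W' \<subseteq> ?q ` U"
      proof (intro exI conjI)
        show "openin circle_topology (circle_proj ` V)" "openin circle_topology (circle_proj ` W)"
          using open_circle_proj VW(1,2) by (simp_all add: open_map_def)
        show "a \<in> circle_proj ` V" "b \<in> circle_proj ` W"
          using xy(2,3) VW(3,4) by simp_all
        have "circle_proj ` V \<times> circle_proj ` W \<subseteq> ?q ` (V \<times> W)"
          by auto
        also have "\<dots> \<subseteq> ?q ` U"
          using VW(5) by (rule image_mono)
        finally show "circle_proj ` V \<times> circle_proj ` W \<subseteq> ?q ` U" .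
      qed
    qed
  qed
  moreover have "continuous_map ?R ?C ?q"
    unfolding continuous_map_prod_top using c by blast
  moreover have "?q ` topspace ?R = topspace ?C"
    by (auto simp: topspace_circle_topology carrier_circle_group image_iff)
  ultimately have q: "quotient_map ?R ?C ?q"
    by (metis continuous_open_imp_quotient_map)
  have "continuous_map ?R circle_topology (circle_proj \<circ> (\<lambda>z. fst z + snd z))"
    by (rule continuous_map_compose[OF _ c]) (simp add: continuous_intros)
  then have "continuous_map ?R circle_topology ((\<lambda>(a, b). a \<otimes>\<^bsub>circle_group\<^esub> b) \<circ> ?q)"
    by (simp add: o_def case_prod_beta circle_proj_add)
  then show ?thesis
    using continuous_compose_quotient_map[OF q] by blast
qed

lemma characters_closed:
  assumes "group G" "\<xi> \<in> characters G \<tau>" "\<eta> \<in> characters G \<tau>" "topspace \<tau> = carrier G"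
  shows "(\<lambda>x\<in>carrier G. \<xi> x \<otimes>\<^bsub>circle_group\<^esub> \<eta> x) \<in> characters G \<tau>"
proof -
  interpret G: group G by fact
  interpret T: comm_group circle_group by (rule comm_group_circle_group)
  have "continuous_map \<tau> circle_topology
     ((\<lambda>(a, b). a \<otimes>\<^bsub>circle_group\<^esub> b) \<circ> (\<lambda>x. (\<xi> x, \<eta> x)))"
    using assms
    by (intro continuous_map_compose[OF _ continuous_map_circle_mult])
      (auto simp: characters_def continuous_map_pairwise o_def)
  then have "continuous_map \<tau> circle_topology (\<lambda>x\<in>carrier G. \<xi> x \<otimes>\<^bsub>circle_group\<^esub> \<eta> x)"
    by (rule continuous_map_eq) (use assms in auto)
  moreover have "(\<lambda>x\<in>carrier G. \<xi> x \<otimes>\<^bsub>circle_group\<^esub> \<eta> x) \<in> hom G circle_group"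
    using assms(2,3)
    by (auto simp: characters_def hom_def Pi_iff T.m_ac)
  ultimately show ?thesis
    by (simp add: characters_def)
qed

lemma continuous_map_circle_inv:
  "continuous_map circle_topology circle_topology (\<lambda>a. inv\<^bsub>circle_group\<^esub> a)"
proof -
  interpret T: comm_group circle_group by (rule comm_group_circle_group)
  have c: "continuous_map euclideanreal circle_topology circle_proj"
    using quotient_map_circle_proj by (rule quotient_imp_continuous_map)
  have one: "\<one>\<^bsub>circle_group\<^esub> = circle_proj 0"
    by (auto simp: circle_group_def FactGroup_def circle_proj_def r_coset_def real_group_def)
  have "inv\<^bsub>circle_group\<^esub> circle_proj x = circle_proj (- x)" for x
    by (rule T.inv_equality) (auto simp: circle_proj_add one carrier_circle_group)
  moreover have "continuous_map euclideanreal circle_topology (circle_proj \<circ> uminus)"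
    by (rule continuous_map_compose[OF _ c]) (simp add: continuous_on_minus)
  ultimately have "continuous_map euclideanreal circle_topology
      ((\<lambda>a. inv\<^bsub>circle_group\<^esub> a) \<circ> circle_proj)"
    by (simp add: o_def)
  then show ?thesis
    using continuous_compose_quotient_map[OF quotient_map_circle_proj] by blast
qed

lemma comm_group_dual_group:
  assumes "group G" "topspace \<tau> = carrier G"
  shows "comm_group (dual_group G \<tau>)"
proof -
  interpret G: group G by fact
  interpret T: comm_group circle_group by (rule comm_group_circle_group)
  have val: "\<xi> x \<in> carrier circle_group"
    if "\<xi> \<in> characters G \<tau>" "x \<in> carrier G" for \<xi> x
    using that by (auto simp: characters_def hom_def)
  have one: "(\<lambda>x\<in>carrier G. \<one>\<^bsub>circle_group\<^esub>) \<in> characters G \<tau>"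
  proof -
    have "continuous_map \<tau> circle_topology (\<lambda>x. \<one>\<^bsub>circle_group\<^esub>)"
      by (simp add: topspace_circle_topology)
    then have "continuous_map \<tau> circle_topology (\<lambda>x\<in>carrier G. \<one>\<^bsub>circle_group\<^esub>)"
      by (rule continuous_map_eq) (use assms in auto)
    then show ?thesis
      by (auto simp: characters_def hom_def)
  qed
  have inv: "(\<lambda>x\<in>carrier G. inv\<^bsub>circle_group\<^esub> \<xi> x) \<in> characters G \<tau>"
    if \<xi>: "\<xi> \<in> characters G \<tau>" for \<xi>
  proof -
    have "continuous_map \<tau> circle_topology ((\<lambda>a. inv\<^bsub>circle_group\<^esub> a) \<circ> \<xi>)"
      using \<xi> by (auto simp: characters_def intro: continuous_map_compose[OF _ continuous_map_circle_inv])
    then have "continuous_map \<tau> circle_topology (\<lambda>x\<in>carrier G. inv\<^bsub>circle_group\<^esub> \<xi> x)"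
      by (rule continuous_map_eq) (use assms in auto)
    then show ?thesis
      using \<xi> by (auto simp: characters_def hom_def Pi_iff T.inv_mult)
  qed
  have mult: "(\<lambda>x\<in>carrier G. \<xi> x \<otimes>\<^bsub>circle_group\<^esub> \<eta> x) \<in> characters G \<tau>"
    if "\<xi> \<in> characters G \<tau>" "\<eta> \<in> characters G \<tau>" for \<xi> \<eta>
    using characters_closed[OF assms(1) that assms(2)] .
  let ?D = "dual_group G \<tau>"
  have D: "carrier ?D = characters G \<tau>"
    "\<xi> \<otimes>\<^bsub>?D\<^esub> \<eta> = (\<lambda>x\<in>carrier G. \<xi> x \<otimes>\<^bsub>circle_group\<^esub> \<eta> x)"
    "\<one>\<^bsub>?D\<^esub> = (\<lambda>x\<in>carrier G. \<one>\<^bsub>circle_group\<^esub>)" for \<xi> \<eta>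
    by (simp_all add: dual_group_def)
  show ?thesis
  proof (rule comm_groupI, unfold D)
    fix \<xi> assume \<xi>: "\<xi> \<in> characters G \<tau>"
    show "\<exists>\<eta>\<in>characters G \<tau>. (\<lambda>x\<in>carrier G. \<eta> x \<otimes>\<^bsub>circle_group\<^esub> \<xi> x)
        = (\<lambda>x\<in>carrier G. \<one>\<^bsub>circle_group\<^esub>)"
    proof (rule bexI[OF _ inv[OF \<xi>]], rule restrict_ext)
      fix x assume "x \<in> carrier G"
      then show "(\<lambda>x\<in>carrier G. inv\<^bsub>circle_group\<^esub> \<xi> x) x \<otimes>\<^bsub>circle_group\<^esub> \<xi> x
          = \<one>\<^bsub>circle_group\<^esub>"
        using val[OF \<xi>] by simp
    qed
    have "(\<lambda>x\<in>carrier G. (\<lambda>x\<in>carrier G. \<one>\<^bsub>circle_group\<^esub>) x \<otimes>\<^bsub>circle_group\<^esub> \<xi> x)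
        = restrict \<xi> (carrier G)"
      by (rule restrict_ext) (simp add: val[OF \<xi>])
    also have "\<dots> = \<xi>"
      using \<xi> by (simp add: characters_def extensional_restrict)
    finally show "(\<lambda>x\<in>carrier G. (\<lambda>x\<in>carrier G. \<one>\<^bsub>circle_group\<^esub>) x \<otimes>\<^bsub>circle_group\<^esub> \<xi> x)
        = \<xi>" .
    fix \<eta> assume \<eta>: "\<eta> \<in> characters G \<tau>"
    show "(\<lambda>x\<in>carrier G. \<xi> x \<otimes>\<^bsub>circle_group\<^esub> \<eta> x) \<in> characters G \<tau>"
      by (rule mult[OF \<xi> \<eta>])
    show "(\<lambda>x\<in>carrier G. \<xi> x \<otimes>\<^bsub>circle_group\<^esub> \<eta> x)
        = (\<lambda>x\<in>carrier G. \<eta> x \<otimes>\<^bsub>circle_group\<^esub> \<xi> x)"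
      by (rule restrict_ext) (rule T.m_comm[OF val[OF \<xi>] val[OF \<eta>]])
    fix \<zeta> assume \<zeta>: "\<zeta> \<in> characters G \<tau>"
    show "(\<lambda>x\<in>carrier G. (\<lambda>x\<in>carrier G. \<xi> x \<otimes>\<^bsub>circle_group\<^esub> \<eta> x) x \<otimes>\<^bsub>circle_group\<^esub> \<zeta> x)
        = (\<lambda>x\<in>carrier G. \<xi> x \<otimes>\<^bsub>circle_group\<^esub> (\<lambda>x\<in>carrier G. \<eta> x \<otimes>\<^bsub>circle_group\<^esub> \<zeta> x) x)"
      by (rule restrict_ext) (simp add: T.m_assoc[OF val[OF \<xi>] val[OF \<eta>] val[OF \<zeta>]])
  qed (rule one)
qed

lemma dual_endo_hom:
  assumes "group G" "topspace \<tau> = carrier G" "\<phi> \<in> continuous_endo G \<tau>"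
  shows "dual_endo G \<phi> \<in> hom (dual_group G \<tau>) (dual_group G \<tau>)"
proof -
  have \<phi>: "\<phi> x \<in> carrier G" if "x \<in> carrier G" for x
    using assms that by (auto simp: continuous_endo_def hom_def)
  have "dual_endo G \<phi> \<xi> \<in> characters G \<tau>" if \<xi>: "\<xi> \<in> characters G \<tau>" for \<xi>
  proof -
    have "continuous_map \<tau> circle_topology (\<xi> \<circ> \<phi>)"
      using assms \<xi>
      by (auto simp: continuous_endo_def characters_def intro: continuous_map_compose)
    then have "continuous_map \<tau> circle_topology (compose (carrier G) \<xi> \<phi>)"
      by (rule continuous_map_eq) (use assms in \<open>auto simp: compose_def\<close>)
    moreover have "compose (carrier G) \<xi> \<phi> \<in> hom G circle_group"
      using assms \<xi> by (auto simp: continuous_endo_def characters_def intro: group.hom_compose)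
    ultimately show ?thesis
      by (simp add: characters_def dual_endo_def)
  qed
  moreover have "dual_endo G \<phi> (\<lambda>x\<in>carrier G. \<xi> x \<otimes>\<^bsub>circle_group\<^esub> \<eta> x) =
      (\<lambda>x\<in>carrier G. dual_endo G \<phi> \<xi> x \<otimes>\<^bsub>circle_group\<^esub> dual_endo G \<phi> \<eta> x)" for \<xi> \<eta>
    using \<phi> by (auto simp: dual_endo_def compose_def fun_eq_iff restrict_def)
  ultimately show ?thesis
    by (auto simp: hom_def dual_group_def)
qed

end

theory Submission
  imports Defs "HOL-Library.Real_Mod" "HOL-Algebra.Multiplicative_Group"
begin

text \<open>Taking annihilators maps the finite subgroups \<open>F\<close> of the dual onto the open finite-index
  subgroups of \<open>G\<close>, and \<open>F\<close> has as many elements as its annihilator has cosets. The annihilator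
  of the trajectory \<open>T\<^sub>n\<close> of \<open>F\<close> under the dual endomorphism is the cotrajectory \<open>B\<^sub>n\<close> of the
  annihilator of \<open>F\<close>, so the two sequences defining the entropies agree term by term and the two
  suprema range over the same numbers. Surjectivity rests on extending characters of subgroups by the
  divisibility of the circle.\<close>


section \<open>The circle group\<close>

interpretation circle: comm_group circle_group
  by (rule comm_group_circle_group)

lemma circle_proj_eq_iff: "circle_proj x = circle_proj y \<longleftrightarrow> y - x \<in> \<int>"
proof
  assume "circle_proj x = circle_proj y"
  moreover have "0 + y \<in> circle_proj y"
    unfolding circle_proj_def r_coset_def real_group_def by force
  ultimately have "0 + y \<in> circle_proj x"
    by simp
  then show "y - x \<in> \<int>"
    by (auto simp: circle_proj_def r_coset_def real_group_def)
next
  assume *: "y - x \<in> \<int>"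
  have "\<exists>m\<in>\<int>. l + x = m + y" if "l \<in> \<int>" for l
    using that * by (intro bexI[of _ "l - (y - x)"]) auto
  moreover have "\<exists>m\<in>\<int>. l + y = m + x" if "l \<in> \<int>" for l
    using that * by (intro bexI[of _ "l + (y - x)"]) auto
  ultimately show "circle_proj x = circle_proj y"
    by (auto simp: circle_proj_def r_coset_def real_group_def)
qed

lemma one_circle_group: "\<one>\<^bsub>circle_group\<^esub> = circle_proj 0"
  by (auto simp: circle_group_def FactGroup_def circle_proj_def r_coset_def real_group_def)

lemma circle_proj_eq_one_iff: "circle_proj x = \<one>\<^bsub>circle_group\<^esub> \<longleftrightarrow> x \<in> \<int>"
  unfolding one_circle_group circle_proj_eq_iff
  using minus_in_Ints_iff[of x] by simp

lemma circle_proj_in_carrier [simp]: "circle_proj x \<in> carrier circle_group"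
  by (simp add: carrier_circle_group)

section \<open>Powers, torsion and roots in the circle\<close>

lemma circle_proj_nat_pow:
  "circle_proj x [^]\<^bsub>circle_group\<^esub> (n::nat) = circle_proj (real n * x)"
  by (induction n) (simp_all add: one_circle_group circle_proj_add algebra_simps)

text \<open>If \<open>x\<close> represents an \<open>m\<close>-torsion element then
  \<open>m * x\<close> is an integer \<open>k\<close>, and replacing \<open>k\<close> by its
  remainder mod \<open>m\<close> changes \<open>x\<close> by an integer. So the \<open>m\<close>
  fractions \<open>j / m\<close> represent all such elements. This bounds the number of values that
  torsion characters can take.\<close>

lemma finite_circle_torsion:
  assumes "m > 0"
  shows "finite {c \<in> carrier circle_group. c [^]\<^bsub>circle_group\<^esub> (m::nat) = \<one>\<^bsub>circle_group\<^esub>}"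
proof (rule finite_subset)
  show "{c \<in> carrier circle_group. c [^]\<^bsub>circle_group\<^esub> m = \<one>\<^bsub>circle_group\<^esub>}
    \<subseteq> (\<lambda>j. circle_proj (of_int j / real m)) ` {0..<int m}"
  proof safe
    fix c assume c: "c \<in> carrier circle_group" "c [^]\<^bsub>circle_group\<^esub> m = \<one>\<^bsub>circle_group\<^esub>"
    then obtain x where x: "c = circle_proj x" by (auto simp: carrier_circle_group)
    from c(2) have "real m * x \<in> \<int>"
      by (simp add: x circle_proj_nat_pow circle_proj_eq_one_iff)
    then obtain k where k: "real m * x = of_int k" by (auto elim: Ints_cases)
    have "(of_int k :: real) = of_int (int m * (k div int m) + k mod int m)"
      by simp
    also have "\<dots> = real m * of_int (k div int m) + of_int (k mod int m)"
      unfolding of_int_add of_int_mult by simp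
    finally have "of_int (k mod int m) / real m - x = of_int (- (k div int m))"
      using k assms by (simp add: field_simps)
    then have "c = circle_proj (of_int (k mod int m) / real m)"
      unfolding x circle_proj_eq_iff by (metis Ints_of_int)
    then show "c \<in> (\<lambda>j. circle_proj (of_int j / real m)) ` {0..<int m}"
      using assms by auto
  qed
qed simp

lemma circle_divisible:
  assumes "c \<in> carrier circle_group" "k > 0"
  shows "\<exists>y\<in>carrier circle_group. y [^]\<^bsub>circle_group\<^esub> (k::nat) = c"
proof -
  obtain x where "c = circle_proj x" using assms(1) by (auto simp: carrier_circle_group)
  then show ?thesis
    using assms(2) by (intro bexI[of _ "circle_proj (x / real k)"]) (simp_all add: circle_proj_nat_pow)
qed

text \<open>The class of \<open>1 / k\<close> works. It provides the nontrivial value from which a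
  separating character is built.\<close>

lemma circle_root_of_unity:
  assumes "k > 1"
  shows "\<exists>y\<in>carrier circle_group. y \<noteq> \<one>\<^bsub>circle_group\<^esub> \<and> y [^]\<^bsub>circle_group\<^esub> (k::nat) = \<one>\<^bsub>circle_group\<^esub>"
proof (intro bexI conjI)
  have "1 / real k \<notin> \<int>"
  proof
    assume "1 / real k \<in> \<int>"
    then obtain n where n: "1 / real k = of_int n" by (auto elim: Ints_cases)
    have "0 < 1 / real k" "1 / real k < 1" using assms by simp_all
    then have "0 < n" "n < 1" unfolding n by linarith+
    then show False by simp
  qed
  then show "circle_proj (1 / real k) \<noteq> \<one>\<^bsub>circle_group\<^esub>"
    by (simp add: circle_proj_eq_one_iff)
  show "circle_proj (1 / real k) [^]\<^bsub>circle_group\<^esub> k = \<one>\<^bsub>circle_group\<^esub>"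
    using assms by (simp add: circle_proj_nat_pow circle_proj_eq_one_iff)
qed simp

text \<open>The preimage of a point under \<open>circle_proj\<close> is a translate of the integers,
  which is closed in the reals.\<close>

lemma closedin_circle_singleton:
  assumes "c \<in> carrier circle_group"
  shows "closedin circle_topology {c}"
proof -
  obtain x where x: "c = circle_proj x" using assms by (auto simp: carrier_circle_group)
  have "circle_proj -` (carrier circle_group - {c}) = - ((+) x ` \<int>)"
  proof (intro Set.set_eqI iffI)
    fix y assume "y \<in> circle_proj -` (carrier circle_group - {c})"
    then have "y - x \<notin> \<int>" using x circle_proj_eq_iff[of x y] by auto
    then show "y \<in> - ((+) x ` \<int>)" by auto
  next
    fix y assume "y \<in> - ((+) x ` \<int>)"
    then have "y - x \<notin> \<int>" by (force simp: image_iff)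
    then show "y \<in> circle_proj -` (carrier circle_group - {c})"
      using x circle_proj_eq_iff[of x y] by auto
  qed
  moreover have "closed ((+) x ` \<int>)" by (intro closed_translation closed_Ints)
  ultimately show ?thesis
    using assms
    by (auto simp: closedin_def topspace_circle_topology openin_circle_topology)
qed

text \<open>The standard embedding of R/Z into the nonzero complex numbers, exp(2 pi i x). It moves
  character values into a field, where they can be summed. The chosen representative does not
  matter, by \<open>circle_cis_proj\<close>.\<close>

definition circle_cis :: "real set \<Rightarrow> complex" where
  "circle_cis c = cis (2 * pi * (SOME x. c = circle_proj x))"

lemma circle_cis_proj: "circle_cis (circle_proj x) = cis (2 * pi * x)"
proof -
  define y where "y = (SOME y. circle_proj x = circle_proj y)"
  have "circle_proj x = circle_proj y" unfolding y_def by (rule someI_ex) blast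
  then have "y - x \<in> \<int>" by (simp add: circle_proj_eq_iff)
  then have "cis (2 * pi * y) = cis (2 * pi * x)"
    using cis_mult[of "2 * pi * (y - x)" "2 * pi * x"]
    by (simp only: cis_multiple_2pi) (simp add: algebra_simps)
  then show ?thesis by (simp add: circle_cis_def y_def)
qed

lemma circle_cis_mult:
  assumes "a \<in> carrier circle_group" "b \<in> carrier circle_group"
  shows "circle_cis (a \<otimes>\<^bsub>circle_group\<^esub> b) = circle_cis a * circle_cis b"
  using assms by (auto simp: carrier_circle_group circle_proj_add circle_cis_proj cis_mult algebra_simps)

lemma circle_cis_eq_1_iff:
  assumes "a \<in> carrier circle_group"
  shows "circle_cis a = 1 \<longleftrightarrow> a = \<one>\<^bsub>circle_group\<^esub>"
proof -
  obtain x where x: "a = circle_proj x" using assms by (auto simp: carrier_circle_group)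
  have "cis (2 * pi * x) = 1 \<longleftrightarrow> x \<in> \<int>"
    by (auto simp: cis_eq_1_iff Ints_def)
  then show ?thesis by (simp add: x circle_cis_proj circle_proj_eq_one_iff)
qed

lemma circle_cis_one: "circle_cis \<one>\<^bsub>circle_group\<^esub> = 1"
  by (simp add: circle_cis_eq_1_iff)


section \<open>Extension of characters\<close>

text \<open>The exponents \<open>i\<close> with \<open>a [^] i\<close> in \<open>H\<close> form a
  subgroup of the integers, and \<open>m\<close> makes it nonzero. Its least positive element
  \<open>k\<close>, the order of \<open>a\<close> modulo \<open>H\<close>, generates it.\<close>

lemma (in group) int_pow_mem_subgroup_iff:
  assumes "subgroup H G" "a \<in> carrier G" "m > 0" "a [^] (m::nat) \<in> H"
  obtains k :: nat where "k > 0" "\<And>i::int. a [^] i \<in> H \<longleftrightarrow> int k dvd i"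
proof -
  define k where "k = (LEAST k. k > 0 \<and> a [^] (k::nat) \<in> H)"
  have "k > 0 \<and> a [^] k \<in> H"
    unfolding k_def by (rule LeastI[of _ m]) (use assms in auto)
  then have k: "k > 0" "a [^] k \<in> H" by auto
  have least: "k \<le> j" if "j > 0" "a [^] j \<in> H" for j :: nat
    unfolding k_def by (rule Least_le) (use that in auto)
  have mult: "a [^] (int k * i) \<in> H" for i :: int
    using subgroup_int_pow_closed[OF assms(1) k(2), of i] assms(2)
    by (simp add: int_pow_pow int_pow_int[symmetric])
  have "a [^] i \<in> H \<longleftrightarrow> int k dvd i" for i :: int
  proof
    assume i: "a [^] i \<in> H"
    \<comment> \<open>The remainder of \<open>i\<close> mod \<open>k\<close> is again an admissible
      exponent and is smaller than \<open>k\<close>, so minimality forces it to be 0.\<close>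
    have "a [^] (i mod int k) = a [^] (i + int k * (- (i div int k)))"
      by (simp add: minus_div_mult_eq_mod[symmetric] algebra_simps)
    also have "\<dots> = a [^] i \<otimes> a [^] (int k * (- (i div int k)))"
      using assms(2) by (rule int_pow_mult)
    also have "\<dots> \<in> H" using i mult assms(1) by (simp only: subgroup.m_closed)
    finally have "a [^] nat (i mod int k) \<in> H"
      using k(1) by (metis int_pow_int nat_0_le pos_mod_sign of_nat_0_less_iff)
    with least[of "nat (i mod int k)"] k(1) have "\<not> nat (i mod int k) > 0"
      by (metis leD nat_less_iff of_nat_0_less_iff pos_mod_bound pos_mod_sign)
    then show "int k dvd i" using k(1) by (metis dvd_eq_mod_eq_0 nat_0_iff neq0_conv of_nat_0_less_iff order_antisym pos_mod_sign)
  next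
    assume "int k dvd i"
    then show "a [^] i \<in> H" using mult by (auto elim: dvdE)
  qed
  with k(1) show thesis by (rule that)
qed

text \<open>On the subgroup generated by \<open>H\<close> and \<open>a\<close> the only candidate
  sends \<open>h \<otimes> a [^] i\<close> to the product of \<open>\<xi> h\<close> and the
  \<open>i\<close>-th power of \<open>y\<close>. Hypothesis \<open>compat\<close> says that the two
  prescriptions agree on the powers of \<open>a\<close> in \<open>H\<close>, which makes the
  candidate well defined.\<close>

lemma (in comm_group) extend_hom:
  assumes "comm_group T"
    and H: "subgroup H G" and \<xi>: "\<xi> \<in> hom (G\<lparr>carrier := H\<rparr>) T"
    and a: "a \<in> carrier G" and y: "y \<in> carrier T"
    and compat: "\<And>i::int. a [^] i \<in> H \<Longrightarrow> \<xi> (a [^] i) = y [^]\<^bsub>T\<^esub> i"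
  obtains H' \<xi>' where "subgroup H' G" "H \<subseteq> H'" "a \<in> H'" "\<xi>' \<in> hom (G\<lparr>carrier := H'\<rparr>) T"
    "\<And>h. h \<in> H \<Longrightarrow> \<xi>' h = \<xi> h" "\<xi>' a = y"
proof -
  interpret T: comm_group T by fact
  interpret H: subgroup H G by fact
  have val: "\<xi> h \<in> carrier T" if "h \<in> H" for h
    using \<xi> that by (auto simp: hom_def)
  have mul: "\<xi> (g \<otimes> h) = \<xi> g \<otimes>\<^bsub>T\<^esub> \<xi> h" if "g \<in> H" "h \<in> H" for g h
    using \<xi> that by (auto simp: hom_def)
  have one: "\<xi> \<one> = \<one>\<^bsub>T\<^esub>"
    using compat[of 0] H.one_closed by simp
  define H' where "H' = {h \<otimes> a [^] (i::int) | h i. h \<in> H}"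
  define \<xi>' where "\<xi>' = (\<lambda>z. SOME t. \<exists>h\<in>H. \<exists>i::int. z = h \<otimes> a [^] i \<and> t = \<xi> h \<otimes>\<^bsub>T\<^esub> y [^]\<^bsub>T\<^esub> i)"
  \<comment> \<open>Two representations of one element force \<open>a [^] (i - j)\<close> into
    \<open>H\<close>; \<open>compat\<close> at this exponent turns one value into the other. Hence
    the choice made in \<open>\<xi>'\<close> is harmless.\<close>
  have wd: "\<xi> h \<otimes>\<^bsub>T\<^esub> y [^]\<^bsub>T\<^esub> i = \<xi> g \<otimes>\<^bsub>T\<^esub> y [^]\<^bsub>T\<^esub> j"
    if hg: "h \<in> H" "g \<in> H" and eq: "h \<otimes> a [^] i = g \<otimes> a [^] j" for h g and i j :: int
  proof -
    have "h \<otimes> a [^] (i - j) = (h \<otimes> a [^] i) \<otimes> inv (a [^] j)"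
      using hg a by (simp add: int_pow_diff m_assoc)
    also have "\<dots> = g"
      unfolding eq using hg a by (simp add: m_assoc)
    finally have g: "g = h \<otimes> a [^] (i - j)" ..
    then have "a [^] (i - j) = inv h \<otimes> g"
      using hg a by (simp add: m_assoc[symmetric])
    then have mem: "a [^] (i - j) \<in> H"
      using hg by simp
    have "\<xi> g = \<xi> h \<otimes>\<^bsub>T\<^esub> y [^]\<^bsub>T\<^esub> (i - j)"
      unfolding g mul[OF hg(1) mem] compat[OF mem] ..
    then show ?thesis
      using hg val y by (simp add: T.int_pow_mult[symmetric] T.m_assoc)
  qed
  have \<xi>': "\<xi>' (h \<otimes> a [^] i) = \<xi> h \<otimes>\<^bsub>T\<^esub> y [^]\<^bsub>T\<^esub> i" if "h \<in> H" for h and i :: int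
    unfolding \<xi>'_def
  proof (rule some_equality)
    fix t assume "\<exists>g\<in>H. \<exists>j::int. h \<otimes> a [^] i = g \<otimes> a [^] j \<and> t = \<xi> g \<otimes>\<^bsub>T\<^esub> y [^]\<^bsub>T\<^esub> j"
    then obtain g j where g: "g \<in> H" "h \<otimes> a [^] i = g \<otimes> a [^] (j::int)"
      "t = \<xi> g \<otimes>\<^bsub>T\<^esub> y [^]\<^bsub>T\<^esub> j" by blast
    show "t = \<xi> h \<otimes>\<^bsub>T\<^esub> y [^]\<^bsub>T\<^esub> i"
      unfolding g(3) using wd[OF that g(1,2)] by simp
  qed (use that in blast)
  have prod: "(h \<otimes> a [^] i) \<otimes> (g \<otimes> a [^] j) = (h \<otimes> g) \<otimes> a [^] (i + j)"
    if "h \<in> H" "g \<in> H" for h g and i j :: int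
    using that a by (simp add: int_pow_mult m_ac)
  show thesis
  proof (rule that)
    show "subgroup H' G"
    proof (rule subgroupI)
      show "H' \<subseteq> carrier G" using a by (auto simp: H'_def)
      show "H' \<noteq> {}" unfolding H'_def using H.one_closed by blast
      show "inv z \<in> H'" if "z \<in> H'" for z
      proof -
        from that obtain h i where "h \<in> H" "z = h \<otimes> a [^] (i::int)" by (auto simp: H'_def)
        then have "inv z = inv h \<otimes> a [^] (- i)" using a by (simp add: inv_mult int_pow_neg)
        then show ?thesis using \<open>h \<in> H\<close> unfolding H'_def by blast
      qed
      show "z \<otimes> w \<in> H'" if zw: "z \<in> H'" "w \<in> H'" for z w
      proof -
        from zw(1) obtain h i where h: "h \<in> H" "z = h \<otimes> a [^] (i::int)" by (auto simp: H'_def)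
        from zw(2) obtain g j where g: "g \<in> H" "w = g \<otimes> a [^] (j::int)" by (auto simp: H'_def)
        show ?thesis unfolding h(2) g(2) prod[OF h(1) g(1)] H'_def using h(1) g(1) by blast
      qed
    qed
    show "H \<subseteq> H'"
    proof
      fix h assume "h \<in> H"
      then have "h = h \<otimes> a [^] (0::int)" by simp
      with \<open>h \<in> H\<close> show "h \<in> H'" unfolding H'_def by blast
    qed
    have "a = \<one> \<otimes> a [^] (1::int)" using a by simp
    then show "a \<in> H'" unfolding H'_def using H.one_closed by blast
    show "\<xi>' a = y"
      using \<xi>'[OF H.one_closed, of 1] a y one by simp
    show "\<xi>' h = \<xi> h" if "h \<in> H" for h
      using \<xi>'[OF that, of 0] that val by simp
    show "\<xi>' \<in> hom (G\<lparr>carrier := H'\<rparr>) T"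
    proof (rule homI, simp_all)
      show "\<xi>' z \<in> carrier T" if "z \<in> H'" for z
        using that y val by (auto simp: H'_def \<xi>')
      show "\<xi>' (z \<otimes> w) = \<xi>' z \<otimes>\<^bsub>T\<^esub> \<xi>' w" if zw: "z \<in> H'" "w \<in> H'" for z w
      proof -
        from zw(1) obtain h i where h: "h \<in> H" "z = h \<otimes> a [^] (i::int)" by (auto simp: H'_def)
        from zw(2) obtain g j where g: "g \<in> H" "w = g \<otimes> a [^] (j::int)" by (auto simp: H'_def)
        show ?thesis
          using h(1) g(1) val y
          unfolding h(2) g(2) prod[OF h(1) g(1)] \<xi>'[OF h(1)] \<xi>'[OF g(1)] \<xi>'[OF H.m_closed[OF h(1) g(1)]]
          by (simp add: mul T.int_pow_mult T.m_ac)
      qed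
    qed
  qed
qed

text \<open>Lagrange's theorem in the finite quotient by \<open>N\<close>.\<close>

lemma (in comm_group) pow_card_rcosets_mem:
  assumes "subgroup N G" "finite (rcosets N)" "a \<in> carrier G"
  shows "a [^] card (rcosets N) \<in> N"
proof -
  interpret N: normal N G using assms(1) by (rule subgroup_imp_normal)
  interpret Q: group "G Mod N" by (rule N.factorgroup_is_group)
  have pow: "(N #> a) [^]\<^bsub>G Mod N\<^esub> n = N #> (a [^] n)" for n :: nat
    using assms(3) by (induction n) (simp_all add: N.rcos_sum N.subset)
  have "N #> a \<in> carrier (G Mod N)"
    using assms(3) by (auto simp: FactGroup_def RCOSETS_def)
  then have "(N #> a) [^]\<^bsub>G Mod N\<^esub> order (G Mod N) = N"
    using Q.pow_order_eq_1[of "N #> a"] by simp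
  then have "N #> (a [^] card (rcosets N)) = N"
    by (simp only: pow) (simp add: order_def FactGroup_def)
  then show ?thesis
    using assms by (metis coset_join1 nat_pow_closed)
qed

text \<open>Start on the subgroup generated by \<open>N\<close> and \<open>x\<close>, then extend
  one generator at a time. As \<open>N\<close> has finite index, only finitely many subgroups lie
  above it, so a maximal domain exists without Zorn's lemma; divisibility of the circle shows that
  it is all of \<open>G\<close>.\<close>

lemma (in comm_group) separating_circle_hom:
  assumes N: "subgroup N G" "finite (rcosets N)" and x: "x \<in> carrier G" "x \<notin> N"
  obtains \<xi> where "\<xi> \<in> hom G circle_group" "\<And>z. z \<in> N \<Longrightarrow> \<xi> z = \<one>\<^bsub>circle_group\<^esub>"
    "\<xi> x \<noteq> \<one>\<^bsub>circle_group\<^esub>"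
proof -
  let ?T = circle_group
  let ?m = "card (rcosets N)"
  have m: "?m > 0"
    using assms by (metis card_gt_0_iff empty_iff subgroup.subgroup_in_rcosets is_group)
  define S where "S = {H. subgroup H G \<and> N \<subseteq> H \<and> x \<in> H \<and> (\<exists>\<xi>\<in>hom (G\<lparr>carrier := H\<rparr>) ?T.
    (\<forall>z\<in>N. \<xi> z = \<one>\<^bsub>?T\<^esub>) \<and> \<xi> x \<noteq> \<one>\<^bsub>?T\<^esub>)}"
  \<comment> \<open>A subgroup above \<open>N\<close> is the union of the cosets of \<open>N\<close>
    that it contains, so it is determined by a subset of a finite set.\<close>
  have "finite {H. subgroup H G \<and> N \<subseteq> H}"
  proof (rule finite_imageD)
    show "finite ((\<lambda>H. {C \<in> rcosets N. C \<subseteq> H}) ` {H. subgroup H G \<and> N \<subseteq> H})"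
      by (rule finite_subset[of _ "Pow (rcosets N)"]) (use N in auto)
    have "H = \<Union> {C \<in> rcosets N. C \<subseteq> H}" if H: "subgroup H G" "N \<subseteq> H" for H
    proof (intro equalityI subsetI)
      fix h assume h: "h \<in> H"
      then have hG: "h \<in> carrier G" using H by (auto dest: subgroup.subset)
      have "N #> h \<subseteq> H" using H h by (auto simp: r_coset_def intro: subgroup.m_closed)
      then show "h \<in> \<Union> {C \<in> rcosets N. C \<subseteq> H}"
        using hG N rcos_self[OF hG N(1)] by (auto simp: RCOSETS_def)
    qed auto
    then show "inj_on (\<lambda>H. {C \<in> rcosets N. C \<subseteq> H}) {H. subgroup H G \<and> N \<subseteq> H}"
      by (intro inj_onI) (metis (mono_tags, lifting) mem_Collect_eq)
  qed
  then have "finite S" by (rule finite_subset[rotated]) (auto simp: S_def)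
  moreover have "S \<noteq> {}"
  proof -
    \<comment> \<open>The order \<open>k\<close> of \<open>x\<close> modulo \<open>N\<close> exceeds
      1 because \<open>x \<notin> N\<close>. Sending \<open>x\<close> to a nontrivial
      \<open>k\<close>-th root of unity is compatible with being trivial on
      \<open>N\<close>.\<close>
    obtain k :: nat where k: "k > 0" "\<And>i::int. x [^] i \<in> N \<longleftrightarrow> int k dvd i"
      by (rule int_pow_mem_subgroup_iff[OF N(1) x(1) m pow_card_rcosets_mem[OF N x(1)]]) blast
    have "k \<noteq> 1" using k(2)[of 1] x by auto
    with k(1) have "k > 1" by simp
    then obtain y where y: "y \<in> carrier ?T" "y \<noteq> \<one>\<^bsub>?T\<^esub>" "y [^]\<^bsub>?T\<^esub> k = \<one>\<^bsub>?T\<^esub>"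
      using circle_root_of_unity by blast
    have "(\<lambda>_. \<one>\<^bsub>?T\<^esub>) \<in> hom (G\<lparr>carrier := N\<rparr>) ?T" by (auto simp: hom_def)
    moreover have "\<one>\<^bsub>?T\<^esub> = y [^]\<^bsub>?T\<^esub> i" if i: "x [^] i \<in> N" for i :: int
    proof -
      obtain j where j: "i = int k * j" using k(2)[of i] i by (auto simp: dvd_def)
      have "y [^]\<^bsub>?T\<^esub> i = (y [^]\<^bsub>?T\<^esub> int k) [^]\<^bsub>?T\<^esub> j"
        unfolding j by (rule circle.int_pow_pow[OF y(1), symmetric])
      then show ?thesis using y by (simp add: int_pow_int)
    qed
    ultimately obtain H' \<xi>' where "subgroup H' G" "N \<subseteq> H'" "x \<in> H'"
      "\<xi>' \<in> hom (G\<lparr>carrier := H'\<rparr>) ?T" "\<And>h. h \<in> N \<Longrightarrow> \<xi>' h = \<one>\<^bsub>?T\<^esub>" "\<xi>' x = y"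
      using extend_hom[OF comm_group_circle_group N(1) _ x(1) y(1)] by blast
    with y(2) have "H' \<in> S" unfolding S_def by blast
    then show ?thesis by blast
  qed
  ultimately obtain H where HS: "H \<in> S" and max: "\<And>K. K \<in> S \<Longrightarrow> H \<subseteq> K \<Longrightarrow> H = K"
    using finite_has_maximal[of S] by blast
  from HS obtain \<xi> where H: "subgroup H G" "N \<subseteq> H" "x \<in> H"
    and \<xi>: "\<xi> \<in> hom (G\<lparr>carrier := H\<rparr>) ?T" "\<forall>z\<in>N. \<xi> z = \<one>\<^bsub>?T\<^esub>" "\<xi> x \<noteq> \<one>\<^bsub>?T\<^esub>"
    by (auto simp: S_def)
  have "H = carrier G"
  proof (rule ccontr)
    assume "H \<noteq> carrier G"
    then obtain a where a: "a \<in> carrier G" "a \<notin> H"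
      using subgroup.subset[OF H(1)] by blast
    obtain k :: nat where k: "k > 0" "\<And>i::int. a [^] i \<in> H \<longleftrightarrow> int k dvd i"
      using int_pow_mem_subgroup_iff[OF H(1) a(1) m] pow_card_rcosets_mem[OF N a(1)] H(2) by blast
    have ak: "a [^] k \<in> H" using k(2)[of "int k"] by (simp add: int_pow_int)
    then have "\<xi> (a [^] k) \<in> carrier ?T" using \<xi>(1) by (auto simp: hom_def)
    \<comment> \<open>Divisibility supplies a \<open>k\<close>-th root of the value already fixed at
      \<open>a [^] k\<close>. Every power of \<open>a\<close> in \<open>H\<close> is a power of
      \<open>a [^] k\<close>, so no other condition on \<open>y\<close> arises.\<close>
    then obtain y where y: "y \<in> carrier ?T" "y [^]\<^bsub>?T\<^esub> k = \<xi> (a [^] k)"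
      using circle_divisible k(1) by blast
    interpret \<xi>: group_hom "G\<lparr>carrier := H\<rparr>" ?T \<xi>
      using \<xi>(1) subgroup_imp_group[OF H(1)] by (simp add: group_hom_def group_hom_axioms_def)
    have "\<xi> (a [^] i) = y [^]\<^bsub>?T\<^esub> i" if i: "a [^] i \<in> H" for i :: int
    proof -
      obtain j where j: "i = int k * j" using k(2)[of i] i by (auto simp: dvd_def)
      have "\<xi> (a [^] i) = \<xi> ((a [^] int k) [^] j)"
        unfolding j by (simp only: int_pow_pow[OF a(1)])
      also have "\<dots> = \<xi> ((a [^] k) [^] j)"
        by (simp only: int_pow_int)
      also have "\<dots> = \<xi> ((a [^] k) [^]\<^bsub>G\<lparr>carrier := H\<rparr>\<^esub> j)"
        using ak H(1) by (simp add: int_pow_consistent)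
      also have "\<dots> = \<xi> (a [^] k) [^]\<^bsub>?T\<^esub> j"
        using ak by (intro \<xi>.hom_int_pow) simp
      also have "\<dots> = (y [^]\<^bsub>?T\<^esub> int k) [^]\<^bsub>?T\<^esub> j"
        by (simp only: y(2)[symmetric] int_pow_int)
      also have "\<dots> = y [^]\<^bsub>?T\<^esub> i"
        unfolding j by (rule circle.int_pow_pow[OF y(1)])
      finally show ?thesis .
    qed
    then show False
    proof (rule extend_hom[OF comm_group_circle_group H(1) \<xi>(1) a(1) y(1)])
      fix H' \<xi>' assume H': "subgroup H' G" "H \<subseteq> H'" "a \<in> H'"
        and \<xi>': "\<xi>' \<in> hom (G\<lparr>carrier := H'\<rparr>) ?T" "\<And>h. h \<in> H \<Longrightarrow> \<xi>' h = \<xi> h"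
      have "\<forall>z\<in>N. \<xi>' z = \<one>\<^bsub>?T\<^esub>" "\<xi>' x \<noteq> \<one>\<^bsub>?T\<^esub>"
        using H(2,3) \<xi>(2,3) \<xi>'(2) by (metis subsetD)+
      then have "H' \<in> S" unfolding S_def using H H' \<xi>'(1) by blast
      then show False using max[of H'] H' a(2) by blast
    qed
  qed
  with \<xi> show thesis using that[of \<xi>] by simp
qed


section \<open>Annihilators\<close>

definition annihilator :: "('a, 'm) monoid_scheme \<Rightarrow> ('a \<Rightarrow> real set) set \<Rightarrow> 'a set" where
  "annihilator G F = {x \<in> carrier G. \<forall>\<xi>\<in>F. \<xi> x = \<one>\<^bsub>circle_group\<^esub>}"

lemma annihilatorI:
  "x \<in> carrier G \<Longrightarrow> (\<And>\<xi>. \<xi> \<in> F \<Longrightarrow> \<xi> x = \<one>\<^bsub>circle_group\<^esub>) \<Longrightarrow> x \<in> annihilator G F"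
  unfolding annihilator_def by blast

lemma annihilatorD:
  "x \<in> annihilator G F \<Longrightarrow> x \<in> carrier G"
  "x \<in> annihilator G F \<Longrightarrow> \<xi> \<in> F \<Longrightarrow> \<xi> x = \<one>\<^bsub>circle_group\<^esub>"
  unfolding annihilator_def by blast+

section \<open>Coset representatives and sums of multiplicative functions\<close>

definition coset_rep :: "'a set \<Rightarrow> 'a" where
  "coset_rep C = (SOME x. x \<in> C)"

context group
begin

lemma coset_rep:
  assumes "subgroup N G" "C \<in> rcosets N"
  shows "coset_rep C \<in> C" "coset_rep C \<in> carrier G" "N #> coset_rep C = C"
proof -
  obtain x where x: "x \<in> carrier G" "C = N #> x" using assms(2) by (auto simp: RCOSETS_def)
  have "x \<in> C" using x rcos_self assms(1) by simp
  then show rep: "coset_rep C \<in> C" unfolding coset_rep_def by (rule someI)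
  then show "coset_rep C \<in> carrier G" "N #> coset_rep C = C"
    using x repr_independence[of "coset_rep C" N x] assms(1)
      subgroup.elemrcos_carrier[OF assms(1) is_group x(1)]
    by auto
qed

text \<open>Elements of one coset differ by an element of \<open>N\<close>, where
  \<open>\<xi>\<close> is trivial. So evaluation at the chosen representative realises the map that
  \<open>\<xi>\<close> induces on the quotient.\<close>

lemma hom_coset_rep:
  assumes "subgroup N G" "\<xi> \<in> hom G T" "group T" "\<And>z. z \<in> N \<Longrightarrow> \<xi> z = \<one>\<^bsub>T\<^esub>" "x \<in> carrier G"
  shows "\<xi> (coset_rep (N #> x)) = \<xi> x"
proof -
  interpret T: group T by fact
  have "N #> x \<in> rcosets N" using assms(5) by (auto simp: RCOSETS_def)
  then have "coset_rep (N #> x) \<in> N #> x" by (rule coset_rep(1)[OF assms(1)])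
  then obtain n where n: "n \<in> N" "coset_rep (N #> x) = n \<otimes> x" by (auto simp: r_coset_def)
  then have "\<xi> (coset_rep (N #> x)) = \<xi> n \<otimes>\<^bsub>T\<^esub> \<xi> x"
    using assms(2,5) subgroup.mem_carrier[OF assms(1)] by (auto simp: hom_def)
  also have "\<dots> = \<xi> x"
    using assms(2,5) by (simp add: assms(4)[OF n(1)] hom_def Pi_iff)
  finally show ?thesis .
qed

end

text \<open>Translation by \<open>a\<close> permutes the group and multiplies the sum by
  \<open>f a\<close>, which differs from 1.\<close>

lemma (in group) multiplicative_sum_zero:
  fixes f :: "'a \<Rightarrow> complex"
  assumes "\<And>x y. x \<in> carrier G \<Longrightarrow> y \<in> carrier G \<Longrightarrow> f (x \<otimes> y) = f x * f y"
    and "a \<in> carrier G" "f a \<noteq> 1"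
  shows "(\<Sum>x\<in>carrier G. f x) = 0"
proof -
  have "bij_betw (\<lambda>x. a \<otimes> x) (carrier G) (carrier G)"
    using assms(2) surj_const_mult[OF assms(2)] inj_on_cmult[OF assms(2)] by (auto simp: bij_betw_def)
  then have "(\<Sum>x\<in>carrier G. f x) = (\<Sum>x\<in>carrier G. f (a \<otimes> x))"
    by (rule sum.reindex_bij_betw[symmetric])
  also have "\<dots> = f a * (\<Sum>x\<in>carrier G. f x)"
    by (simp add: assms sum_distrib_left)
  finally show ?thesis using assms(3) by simp
qed

section \<open>Pointwise computation in the dual group\<close>

context topological_comm_group
begin

interpretation dual: comm_group "dual_group G \<tau>"
  by (rule comm_group_dual_group[OF is_group topspace_eq])

lemma carrier_dual: "carrier (dual_group G \<tau>) = characters G \<tau>"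
  by (simp add: dual_group_def)

lemma character_hom: "\<xi> \<in> characters G \<tau> \<Longrightarrow> \<xi> \<in> hom G circle_group"
  by (simp add: characters_def)

lemma character_group_hom: "\<xi> \<in> characters G \<tau> \<Longrightarrow> group_hom G circle_group \<xi>"
  by (simp add: group_hom_def group_hom_axioms_def character_hom)

lemma character_closed: "\<xi> \<in> characters G \<tau> \<Longrightarrow> x \<in> carrier G \<Longrightarrow> \<xi> x \<in> carrier circle_group"
  by (auto dest!: character_hom simp: hom_def Pi_iff)

lemma dual_mult_apply:
  "x \<in> carrier G \<Longrightarrow> (\<xi> \<otimes>\<^bsub>dual_group G \<tau>\<^esub> \<eta>) x = \<xi> x \<otimes>\<^bsub>circle_group\<^esub> \<eta> x"
  by (simp add: dual_group_def)

lemma dual_one_apply: "x \<in> carrier G \<Longrightarrow> \<one>\<^bsub>dual_group G \<tau>\<^esub> x = \<one>\<^bsub>circle_group\<^esub>"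
  by (simp add: dual_group_def)

lemma dual_pow_apply:
  "x \<in> carrier G \<Longrightarrow> (\<xi> [^]\<^bsub>dual_group G \<tau>\<^esub> (n::nat)) x = \<xi> x [^]\<^bsub>circle_group\<^esub> n"
  by (induction n) (simp_all add: dual_mult_apply dual_one_apply)

lemma character_eqI:
  assumes "\<xi> \<in> characters G \<tau>" "\<eta> \<in> characters G \<tau>" "\<And>x. x \<in> carrier G \<Longrightarrow> \<xi> x = \<eta> x"
  shows "\<xi> = \<eta>"
  using assms by (auto simp: characters_def intro: extensionalityI)

lemma subgroup_annihilator:
  assumes "F \<subseteq> characters G \<tau>"
  shows "subgroup (annihilator G F) G"
proof (rule subgroupI)
  have hom: "group_hom G circle_group \<xi>" if "\<xi> \<in> F" for \<xi>
    using assms that by (auto intro: character_group_hom)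
  show "annihilator G F \<noteq> {}"
    using hom group_hom.hom_one unfolding annihilator_def by blast
  show "inv a \<in> annihilator G F" if a: "a \<in> annihilator G F" for a
  proof (rule annihilatorI)
    show "\<xi> (inv a) = \<one>\<^bsub>circle_group\<^esub>" if "\<xi> \<in> F" for \<xi>
      using group_hom.hom_inv[OF hom[OF that] annihilatorD(1)[OF a]] annihilatorD(2)[OF a that]
      by simp
  qed (simp add: annihilatorD(1)[OF a])
  show "a \<otimes> b \<in> annihilator G F" if a: "a \<in> annihilator G F" and b: "b \<in> annihilator G F" for a b
  proof (rule annihilatorI)
    show "\<xi> (a \<otimes> b) = \<one>\<^bsub>circle_group\<^esub>" if "\<xi> \<in> F" for \<xi>
      using group_hom.hom_mult[OF hom[OF that] annihilatorD(1)[OF a] annihilatorD(1)[OF b]]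
        annihilatorD(2)[OF a that] annihilatorD(2)[OF b that] by simp
  qed (simp add: annihilatorD(1)[OF a] annihilatorD(1)[OF b])
qed (auto simp: annihilator_def)

text \<open>Lagrange's theorem in \<open>F\<close>, evaluated at \<open>x\<close>. It confines all
  values of members of \<open>F\<close> to a finite torsion set.\<close>

lemma finite_subgroup_torsion:
  assumes F: "subgroup F (dual_group G \<tau>)" "finite F" and "\<xi> \<in> F" "x \<in> carrier G"
  shows "\<xi> x [^]\<^bsub>circle_group\<^esub> card F = \<one>\<^bsub>circle_group\<^esub>"
proof -
  interpret F: group "(dual_group G \<tau>)\<lparr>carrier := F\<rparr>"
    using F(1) by (rule dual.subgroup_imp_group)
  have "\<xi> [^]\<^bsub>(dual_group G \<tau>)\<lparr>carrier := F\<rparr>\<^esub> card F = \<one>\<^bsub>dual_group G \<tau>\<^esub>"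
    using F.pow_order_eq_1[of \<xi>] assms(3) by (simp add: order_def)
  then have "\<xi> [^]\<^bsub>dual_group G \<tau>\<^esub> card F = \<one>\<^bsub>dual_group G \<tau>\<^esub>"
    by (simp add: dual.nat_pow_consistent[symmetric])
  then show ?thesis
    using assms(4) by (metis dual_one_apply dual_pow_apply)
qed

section \<open>Annihilators of finite subgroups of the dual: finite index, openness, index\<close>

lemma card_finite_subgroup_pos:
  "subgroup F (dual_group G \<tau>) \<Longrightarrow> finite F \<Longrightarrow> card F > 0"
  by (metis card_gt_0_iff empty_iff subgroup.one_closed)

text \<open>A coset is determined by the tuple of values that the members of \<open>F\<close> take
  at its representative: if two tuples agree, the quotient of the representatives is annihilated by
  \<open>F\<close>. The tuples have torsion entries, so there are finitely many.\<close>

lemma finite_rcosets_annihilator: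
  assumes F: "subgroup F (dual_group G \<tau>)" "finite F"
  shows "finite (rcosets (annihilator G F))"
proof -
  let ?N = "annihilator G F"
  let ?S = "{c \<in> carrier circle_group. c [^]\<^bsub>circle_group\<^esub> card F = \<one>\<^bsub>circle_group\<^esub>}"
  let ?f = "\<lambda>C. \<lambda>\<xi>\<in>F. \<xi> (coset_rep C)"
  have sub: "F \<subseteq> characters G \<tau>" using subgroup.subset[OF F(1)] by (simp add: carrier_dual)
  have N: "subgroup ?N G" by (rule subgroup_annihilator[OF sub])
  have "?f ` (rcosets ?N) \<subseteq> PiE F (\<lambda>_. ?S)"
    using coset_rep(2)[OF N] finite_subgroup_torsion[OF F] character_closed sub by auto
  moreover have "finite (PiE F (\<lambda>_. ?S))"
    using F finite_circle_torsion[OF card_finite_subgroup_pos[OF F]] by (intro finite_PiE)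
  moreover have "inj_on ?f (rcosets ?N)"
  proof (rule inj_onI)
    fix C D assume CD: "C \<in> rcosets ?N" "D \<in> rcosets ?N" and eq: "?f C = ?f D"
    let ?x = "coset_rep C" and ?y = "coset_rep D"
    have xy: "?x \<in> carrier G" "?y \<in> carrier G" using coset_rep(2)[OF N] CD by auto
    have "\<xi> (?x \<otimes> inv ?y) = \<one>\<^bsub>circle_group\<^esub>" if "\<xi> \<in> F" for \<xi>
    proof -
      interpret group_hom G circle_group \<xi> using sub that by (auto intro: character_group_hom)
      have "\<xi> ?x = \<xi> ?y" using fun_cong[OF eq, of \<xi>] that by simp
      then show ?thesis using xy by simp
    qed
    then have "?x \<otimes> inv ?y \<in> ?N" using xy by (auto simp: annihilator_def)
    then have "?N #> ?x = ?N #> ?y"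
      using xy N by (metis coset_join2 coset_mult_inv1 inv_closed m_closed subgroup.subset)
    then show "C = D" using coset_rep(3)[OF N] CD by simp
  qed
  ultimately show ?thesis by (meson finite_imageD finite_subset)
qed

text \<open>A character of finite order has finite image, so its kernel is the preimage of the
  complement of a finite, hence closed, set.\<close>

lemma openin_annihilator:
  assumes F: "subgroup F (dual_group G \<tau>)" "finite F"
  shows "openin \<tau> (annihilator G F)"
proof -
  let ?S = "{c \<in> carrier circle_group. c [^]\<^bsub>circle_group\<^esub> card F = \<one>\<^bsub>circle_group\<^esub>} - {\<one>\<^bsub>circle_group\<^esub>}"
  \<comment> \<open>Within the torsion values that members of \<open>F\<close> can take,
    \<open>?U\<close> contains only the identity, so its preimage under such a character is the
    kernel.\<close>
  let ?U = "carrier circle_group - ?S"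
  have sub: "F \<subseteq> characters G \<tau>" using subgroup.subset[OF F(1)] by (simp add: carrier_dual)
  have "finite ?S" using finite_circle_torsion[OF card_finite_subgroup_pos[OF F]] by simp
  then have "closedin circle_topology (\<Union>c\<in>?S. {c})"
    by (intro closedin_Union) (auto intro: closedin_circle_singleton)
  then have "openin circle_topology ?U"
    by (simp add: closedin_def topspace_circle_topology)
  then have "openin \<tau> {x \<in> topspace \<tau>. \<xi> x \<in> ?U}" if "\<xi> \<in> F" for \<xi>
    using sub that by (intro openin_continuous_map_preimage) (auto simp: characters_def)
  then have "openin \<tau> ((\<Inter>\<xi>\<in>F. {x \<in> topspace \<tau>. \<xi> x \<in> ?U}) \<inter> topspace \<tau>)"
    using F(2) by (intro openin_INT) auto
  also have "(\<Inter>\<xi>\<in>F. {x \<in> topspace \<tau>. \<xi> x \<in> ?U}) \<inter> topspace \<tau> = annihilator G F"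
    using finite_subgroup_torsion[OF F] character_closed sub
    by (auto simp: annihilator_def topspace_eq)
  finally show ?thesis .
qed

text \<open>Both orthogonality relations evaluate the sum of all \<open>\<xi> x\<close>, taken over
  \<open>\<xi> \<in> F\<close> and the cosets of the annihilator.\<close>

lemma card_rcosets_annihilator:
  assumes F: "subgroup F (dual_group G \<tau>)" "finite F"
  shows "card (rcosets (annihilator G F)) = card F"
proof -
  let ?N = "annihilator G F"
  have sub: "F \<subseteq> characters G \<tau>" using subgroup.subset[OF F(1)] by (simp add: carrier_dual)
  have N: "subgroup ?N G" by (rule subgroup_annihilator[OF sub])
  have fin: "finite (rcosets ?N)" by (rule finite_rcosets_annihilator[OF F])
  interpret N: normal ?N G using N by (rule subgroup_imp_normal)
  interpret Q: group "G Mod ?N" by (rule N.factorgroup_is_group)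
  interpret F: group "(dual_group G \<tau>)\<lparr>carrier := F\<rparr>"
    using F(1) by (rule dual.subgroup_imp_group)
  let ?f = "\<lambda>C \<xi>. circle_cis (\<xi> (coset_rep C))"
  have one: "\<one>\<^bsub>dual_group G \<tau>\<^esub> \<in> F" using F(1) by (rule subgroup.one_closed)
  \<comment> \<open>For fixed \<open>C\<close>, evaluation at the representative is multiplicative
    on the group \<open>F\<close>. It is trivial exactly when the representative lies in the
    annihilator, that is, when \<open>C = ?N\<close>.\<close>
  have inner: "(\<Sum>\<xi>\<in>F. ?f C \<xi>) = (if C = ?N then of_nat (card F) else 0)" if C: "C \<in> rcosets ?N" for C
  proof (cases "C = ?N")
    case True
    then have "coset_rep C \<in> ?N" using coset_rep(1)[OF N C] by simp
    then have "?f C \<xi> = 1" if "\<xi> \<in> F" for \<xi>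
      using annihilatorD(2)[OF _ that] circle_cis_one by metis
    then have "(\<Sum>\<xi>\<in>F. ?f C \<xi>) = (\<Sum>\<xi>\<in>F. 1)"
      by (rule sum.cong[OF refl])
    then show ?thesis using True by simp
  next
    case False
    have rep: "coset_rep C \<in> carrier G" by (rule coset_rep(2)[OF N C])
    have "coset_rep C \<notin> ?N"
      using False coset_rep(3)[OF N C] coset_join2[OF rep N] by metis
    then obtain \<xi> where \<xi>: "\<xi> \<in> F" "\<xi> (coset_rep C) \<noteq> \<one>\<^bsub>circle_group\<^esub>"
      using rep unfolding annihilator_def by blast
    have "(\<Sum>\<xi>\<in>carrier ((dual_group G \<tau>)\<lparr>carrier := F\<rparr>). ?f C \<xi>) = 0"
      by (rule F.multiplicative_sum_zero[of _ \<xi>])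
        (use \<xi> rep sub in \<open>simp_all add: dual_mult_apply circle_cis_mult character_closed circle_cis_eq_1_iff subset_iff\<close>)
    then show ?thesis using False by simp
  qed
  \<comment> \<open>For fixed \<open>\<xi>\<close>, the summand is a multiplicative function on the
    quotient by \<open>?N\<close>, trivial only for the trivial character.\<close>
  have outer: "(\<Sum>C\<in>rcosets ?N. ?f C \<xi>)
      = (if \<xi> = \<one>\<^bsub>dual_group G \<tau>\<^esub> then of_nat (card (rcosets ?N)) else 0)" if \<xi>: "\<xi> \<in> F" for \<xi>
  proof (cases "\<xi> = \<one>\<^bsub>dual_group G \<tau>\<^esub>")
    case True
    then have "(\<Sum>C\<in>rcosets ?N. ?f C \<xi>) = (\<Sum>C\<in>rcosets ?N. 1)"
      using coset_rep(2)[OF N] by (intro sum.cong refl) (simp add: dual_one_apply circle_cis_one)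
    then show ?thesis using True by simp
  next
    case False
    have char: "\<xi> \<in> characters G \<tau>" using \<xi> sub by blast
    interpret \<xi>: group_hom G circle_group \<xi> using char by (rule character_group_hom)
    have rep: "\<xi> (coset_rep (?N #> x)) = \<xi> x" if "x \<in> carrier G" for x
      using that annihilatorD(2)[OF _ \<xi>] by (intro hom_coset_rep[OF N \<xi>.homh circle.is_group])
    obtain x where x: "x \<in> carrier G" "\<xi> x \<noteq> \<one>\<^bsub>circle_group\<^esub>"
      using False character_eqI[OF char] dual.one_closed
      by (metis carrier_dual dual_one_apply)
    have "(\<Sum>C\<in>carrier (G Mod ?N). ?f C \<xi>) = 0"
    proof (rule Q.multiplicative_sum_zero)
      fix C D assume "C \<in> carrier (G Mod ?N)" "D \<in> carrier (G Mod ?N)"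
      then obtain x y where "x \<in> carrier G" "y \<in> carrier G" "C = ?N #> x" "D = ?N #> y"
        by (auto simp: FactGroup_def RCOSETS_def)
      then show "?f (C \<otimes>\<^bsub>G Mod ?N\<^esub> D) \<xi> = ?f C \<xi> * ?f D \<xi>"
        by (simp add: N.rcos_sum rep circle_cis_mult)
    next
      show "?N #> x \<in> carrier (G Mod ?N)" using x(1) by (auto simp: FactGroup_def RCOSETS_def)
      show "?f (?N #> x) \<xi> \<noteq> 1" using x by (simp add: rep circle_cis_eq_1_iff)
    qed
    then show ?thesis using False by (simp add: FactGroup_def)
  qed
  have "?N \<in> rcosets ?N" by (rule N.subgroup_in_rcosets[OF is_group])
  \<comment> \<open>One order of summation leaves only the coset \<open>?N\<close>, contributing
    \<open>card F\<close>; the other leaves only the trivial character, contributing the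
    index.\<close>
  then have "(of_nat (card F) :: complex) = (\<Sum>C\<in>rcosets ?N. \<Sum>\<xi>\<in>F. ?f C \<xi>)"
    using fin by (simp add: inner)
  also have "\<dots> = (\<Sum>\<xi>\<in>F. \<Sum>C\<in>rcosets ?N. ?f C \<xi>)"
    by (rule sum.swap)
  also have "\<dots> = of_nat (card (rcosets ?N))"
    using one F(2) by (simp add: outer)
  finally show ?thesis by simp
qed

section \<open>Open subgroups of finite index as annihilators\<close>

lemma openin_rcoset:
  assumes "subgroup N G" "openin \<tau> N" "x \<in> carrier G"
  shows "openin \<tau> (N #> x)"
proof -
  interpret N: subgroup N G by fact
  \<comment> \<open>The coset is the preimage of \<open>N\<close> under translation by
    \<open>inv x\<close>.\<close>
  have "continuous_map \<tau> \<tau> ((\<lambda>(x, y). x \<otimes> y) \<circ> (\<lambda>z. (z, inv x)))"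
    by (rule continuous_map_compose[OF _ continuous_mult])
      (use assms in \<open>auto simp: continuous_map_pairwise o_def topspace_eq\<close>)
  then have "openin \<tau> {z \<in> topspace \<tau>. ((\<lambda>(x, y). x \<otimes> y) \<circ> (\<lambda>z. (z, inv x))) z \<in> N}"
    using assms(2) by (rule openin_continuous_map_preimage)
  also have "\<dots> = N #> x"
    using assms N.rcos_module[OF is_group assms(3)] N.elemrcos_carrier[OF is_group assms(3)]
    by (auto simp: topspace_eq)
  finally show ?thesis .
qed

text \<open>Being constant on the cosets of the open subgroup \<open>N\<close>, \<open>\<xi>\<close>
  is locally constant and hence continuous. Restricting makes it extensional, as
  \<open>characters\<close> demands.\<close>

lemma restrict_hom_character:
  assumes N: "subgroup N G" "openin \<tau> N"
    and \<xi>: "\<xi> \<in> hom G circle_group" "\<And>z. z \<in> N \<Longrightarrow> \<xi> z = \<one>\<^bsub>circle_group\<^esub>"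
  shows "restrict \<xi> (carrier G) \<in> characters G \<tau>"
proof -
  interpret \<xi>: group_hom G circle_group \<xi>
    by (simp add: group_hom_def group_hom_axioms_def \<xi>(1))
  have "continuous_map \<tau> circle_topology \<xi>"
    unfolding continuous_map_def
  proof (intro conjI allI impI)
    show "\<xi> \<in> topspace \<tau> \<rightarrow> topspace circle_topology"
      by (auto simp: topspace_eq topspace_circle_topology)
    fix U assume "openin circle_topology U"
    show "openin \<tau> {x \<in> topspace \<tau>. \<xi> x \<in> U}"
    proof (subst openin_subopen, intro ballI)
      fix x assume "x \<in> {x \<in> topspace \<tau>. \<xi> x \<in> U}"
      then have x: "x \<in> carrier G" "\<xi> x \<in> U" by (auto simp: topspace_eq)
      have "N #> x \<subseteq> {x \<in> topspace \<tau>. \<xi> x \<in> U}"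
        using x \<xi>(2) subgroup.mem_carrier[OF N(1)] by (auto simp: r_coset_def topspace_eq)
      then show "\<exists>T. openin \<tau> T \<and> x \<in> T \<and> T \<subseteq> {x \<in> topspace \<tau>. \<xi> x \<in> U}"
        using openin_rcoset[OF N x(1)] rcos_self[OF x(1) N(1)] by blast
    qed
  qed
  then have "continuous_map \<tau> circle_topology (restrict \<xi> (carrier G))"
    by (rule continuous_map_eq) (simp add: topspace_eq)
  moreover have "restrict \<xi> (carrier G) \<in> hom G circle_group"
    by (auto simp: hom_def)
  ultimately show ?thesis by (simp add: characters_def)
qed

text \<open>Take for \<open>F\<close> all characters trivial on \<open>N\<close>. Such a character
  is determined by its values at coset representatives, which are torsion of exponent the index, so
  \<open>F\<close> is finite. Separating characters show that \<open>F\<close> annihilates nothing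
  outside \<open>N\<close>.\<close>

lemma open_finite_index_eq_annihilator:
  assumes "N \<in> open_finite_index_subgroups G \<tau>"
  obtains F where "subgroup F (dual_group G \<tau>)" "finite F" "N = annihilator G F"
proof -
  have N: "subgroup N G" "finite (rcosets N)" "openin \<tau> N"
    using assms by (auto simp: open_finite_index_subgroups_def finite_index_subgroups_def)
  have NG: "x \<in> carrier G" if "x \<in> N" for x using N(1) that by (rule subgroup.mem_carrier)
  define F where "F = {\<xi> \<in> characters G \<tau>. \<forall>x\<in>N. \<xi> x = \<one>\<^bsub>circle_group\<^esub>}"
  let ?S = "{c \<in> carrier circle_group. c [^]\<^bsub>circle_group\<^esub> card (rcosets N) = \<one>\<^bsub>circle_group\<^esub>}"
  let ?f = "\<lambda>\<xi>. \<lambda>C\<in>rcosets N. \<xi> (coset_rep C)"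
  show thesis
  proof (rule that)
    show "subgroup F (dual_group G \<tau>)"
    proof (rule dual.subgroupI)
      show "F \<subseteq> carrier (dual_group G \<tau>)" by (auto simp: F_def carrier_dual)
      have "\<one>\<^bsub>dual_group G \<tau>\<^esub> \<in> F"
        using dual.one_closed NG by (auto simp: F_def carrier_dual dual_one_apply)
      then show "F \<noteq> {}" by blast
      show "\<xi> \<otimes>\<^bsub>dual_group G \<tau>\<^esub> \<eta> \<in> F" if "\<xi> \<in> F" "\<eta> \<in> F" for \<xi> \<eta>
        using that dual.m_closed[of \<xi> \<eta>] NG by (auto simp: F_def carrier_dual dual_mult_apply)
      show "inv\<^bsub>dual_group G \<tau>\<^esub> \<xi> \<in> F" if \<xi>: "\<xi> \<in> F" for \<xi>
      proof -
        have char: "\<xi> \<in> carrier (dual_group G \<tau>)" using \<xi> by (simp add: F_def carrier_dual)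
        have inv: "inv\<^bsub>dual_group G \<tau>\<^esub> \<xi> \<in> characters G \<tau>"
          using dual.inv_closed[OF char] by (simp add: carrier_dual)
        have "(inv\<^bsub>dual_group G \<tau>\<^esub> \<xi>) x = \<one>\<^bsub>circle_group\<^esub>" if x: "x \<in> N" for x
        proof -
          have "(\<xi> \<otimes>\<^bsub>dual_group G \<tau>\<^esub> inv\<^bsub>dual_group G \<tau>\<^esub> \<xi>) x = \<one>\<^bsub>circle_group\<^esub>"
            using NG[OF x] by (simp add: dual.r_inv[OF char] dual_one_apply)
          then show ?thesis
            using \<xi> x NG[OF x] character_closed[OF inv] by (simp add: dual_mult_apply F_def)
        qed
        with inv show ?thesis by (simp add: F_def)
      qed
    qed
    show "finite F"
    proof (rule finite_imageD)
      have "?f ` F \<subseteq> PiE (rcosets N) (\<lambda>_. ?S)"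
      proof -
        have "\<xi> x [^]\<^bsub>circle_group\<^esub> card (rcosets N) = \<one>\<^bsub>circle_group\<^esub>"
          if \<xi>: "\<xi> \<in> F" and x: "x \<in> carrier G" for \<xi> x
        proof -
          interpret group_hom G circle_group \<xi>
            using \<xi> by (auto simp: F_def intro: character_group_hom)
          show ?thesis
            using \<xi> pow_card_rcosets_mem[OF N(1,2) x] x by (simp add: hom_nat_pow[symmetric] F_def)
        qed
        then show ?thesis
          using coset_rep(2)[OF N(1)] by (auto simp: F_def character_closed)
      qed
      moreover have "card (rcosets N) > 0"
        using N subgroup.subgroup_in_rcosets[OF N(1) is_group] by (auto simp: card_gt_0_iff)
      ultimately show "finite (?f ` F)"
        using finite_circle_torsion N(2) by (meson finite_PiE finite_subset)
      show "inj_on ?f F"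
      proof (rule inj_onI)
        fix \<xi> \<eta> assume F: "\<xi> \<in> F" "\<eta> \<in> F" and eq: "?f \<xi> = ?f \<eta>"
        show "\<xi> = \<eta>"
        proof (rule character_eqI)
          fix x assume x: "x \<in> carrier G"
          then have C: "N #> x \<in> rcosets N" by (auto simp: RCOSETS_def)
          have "\<zeta> (coset_rep (N #> x)) = \<zeta> x" if "\<zeta> \<in> F" for \<zeta>
            using that x by (intro hom_coset_rep[OF N(1)]) (auto simp: F_def character_hom)
          then show "\<xi> x = \<eta> x" using fun_cong[OF eq, of "N #> x"] C F by (metis restrict_apply')
        qed (use F in \<open>auto simp: F_def\<close>)
      qed
    qed
    show "N = annihilator G F"
    proof (intro equalityI subsetI)
      fix x assume "x \<in> N"
      then show "x \<in> annihilator G F" using NG by (auto simp: annihilator_def F_def)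
    next
      fix x assume x: "x \<in> annihilator G F"
      then have xG: "x \<in> carrier G" by (simp add: annihilator_def)
      show "x \<in> N"
      proof (rule ccontr)
        assume "x \<notin> N"
        \<comment> \<open>The separating homomorphism is purely algebraic; openness of
          \<open>N\<close> makes it a character, and thus a member of \<open>F\<close> nontrivial at
          \<open>x\<close>.\<close>
        then obtain \<xi> where \<xi>: "\<xi> \<in> hom G circle_group"
          "\<And>z. z \<in> N \<Longrightarrow> \<xi> z = \<one>\<^bsub>circle_group\<^esub>" "\<xi> x \<noteq> \<one>\<^bsub>circle_group\<^esub>"
          using separating_circle_hom[OF N(1,2) xG] by blast
        have "restrict \<xi> (carrier G) \<in> F"
          using restrict_hom_character[OF N(1,3) \<xi>(1,2)] \<xi>(2) NG by (auto simp: F_def)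
        then show False using x \<xi>(3) xG by (auto simp: annihilator_def)
      qed
    qed
  qed
qed

section \<open>Trajectories in the dual against cotrajectories in the group\<close>

lemma annihilator_set_mult:
  assumes "subgroup A (dual_group G \<tau>)" "subgroup B (dual_group G \<tau>)"
  shows "annihilator G (A <#>\<^bsub>dual_group G \<tau>\<^esub> B) = annihilator G A \<inter> annihilator G B"
proof (intro equalityI subsetI)
  fix x assume x: "x \<in> annihilator G (A <#>\<^bsub>dual_group G \<tau>\<^esub> B)"
  \<comment> \<open>Each subgroup contains the identity, so both factors lie inside the product and
    are annihilated along with it.\<close>
  have "A \<subseteq> A <#>\<^bsub>dual_group G \<tau>\<^esub> B"
    using assms subgroup.one_closed[OF assms(2)] subgroup.mem_carrier[OF assms(1)]
    unfolding set_mult_def by (force dest: dual.r_one)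
  moreover have "B \<subseteq> A <#>\<^bsub>dual_group G \<tau>\<^esub> B"
    using assms subgroup.one_closed[OF assms(1)] subgroup.mem_carrier[OF assms(2)]
    unfolding set_mult_def by (force dest: dual.l_one)
  ultimately show "x \<in> annihilator G A \<inter> annihilator G B"
    using x by (auto simp: annihilator_def)
next
  fix x assume x: "x \<in> annihilator G A \<inter> annihilator G B"
  then have xG: "x \<in> carrier G" by (simp add: annihilator_def)
  have "(\<xi> \<otimes>\<^bsub>dual_group G \<tau>\<^esub> \<eta>) x = \<one>\<^bsub>circle_group\<^esub>" if "\<xi> \<in> A" "\<eta> \<in> B" for \<xi> \<eta>
    using annihilatorD(2)[of x G A \<xi>] annihilatorD(2)[of x G B \<eta>] x that
    by (simp add: dual_mult_apply[OF xG])
  with xG show "x \<in> annihilator G (A <#>\<^bsub>dual_group G \<tau>\<^esub> B)"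
    unfolding annihilator_def set_mult_def by blast
qed

text \<open>Each application of the dual endomorphism precomposes with \<open>\<phi>\<close>. The
  point \<open>x\<close> varies in the induction because the hypothesis is used at
  \<open>\<phi> x\<close>.\<close>

lemma funpow_dual_endo_apply:
  assumes "\<phi> \<in> continuous_endo G \<tau>" "x \<in> carrier G"
  shows "((dual_endo G \<phi> ^^ n) \<xi>) x = \<xi> ((\<phi> ^^ n) x)"
  using assms(2)
proof (induction n arbitrary: x)
  case (Suc n)
  moreover have "\<phi> x \<in> carrier G"
    using assms(1) Suc.prems by (auto simp: continuous_endo_def hom_def)
  ultimately show ?case
    by (simp add: dual_endo_def[of G \<phi> "(dual_endo G \<phi> ^^ n) \<xi>"] compose_eq funpow_swap1[of \<phi>])
qed simp

context
  fixes \<phi> :: "'a \<Rightarrow> 'a" and F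
  assumes \<phi>: "\<phi> \<in> continuous_endo G \<tau>" and F: "subgroup F (dual_group G \<tau>)" "finite F"
begin

lemma subgroup_funpow_image: "subgroup ((dual_endo G \<phi> ^^ n) ` F) (dual_group G \<tau>)"
proof (induction n)
  case (Suc n)
  interpret \<psi>: group_hom "dual_group G \<tau>" "dual_group G \<tau>" "dual_endo G \<phi>"
    using dual_endo_hom[OF is_group topspace_eq \<phi>] by unfold_locales
  show ?case using \<psi>.subgroup_img_is_subgroup[OF Suc.IH] by (simp add: image_comp)
qed (simp add: F)

lemma subgroup_trajectory:
  "subgroup (trajectory (dual_group G \<tau>) (dual_endo G \<phi>) F n) (dual_group G \<tau>)"
  by (induction n) (simp_all add: dual.triv_subgroup dual.mult_subgroups subgroup_funpow_image)

lemma finite_trajectory: "finite (trajectory (dual_group G \<tau>) (dual_endo G \<phi>) F n)"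
  using F(2) by (induction n) (auto simp: set_mult_def)

text \<open>The factor added at stage \<open>n\<close> is the image of \<open>F\<close> under the
  \<open>n\<close>-th iterate of the dual endomorphism, and its annihilator is the preimage of
  \<open>annihilator G F\<close> under \<open>\<phi> ^^ n\<close>. Products become intersections; at
  \<open>n = 0\<close> both sides are the whole group.\<close>

lemma annihilator_trajectory:
  "annihilator G (trajectory (dual_group G \<tau>) (dual_endo G \<phi>) F n)
    = cotrajectory G \<phi> (annihilator G F) n"
proof (induction n)
  case 0
  then show ?case by (auto simp: annihilator_def cotrajectory_def dual_one_apply)
next
  case (Suc n)
  have closed: "(\<phi> ^^ n) x \<in> carrier G" if "x \<in> carrier G" for x
    using that \<phi> by (induction n) (auto simp: continuous_endo_def hom_def)
  have "annihilator G ((dual_endo G \<phi> ^^ n) ` F) = {x \<in> carrier G. (\<phi> ^^ n) x \<in> annihilator G F}"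
    using closed by (auto simp: annihilator_def funpow_dual_endo_apply[OF \<phi>])
  then show ?case
    by (auto simp: annihilator_set_mult subgroup_trajectory subgroup_funpow_image Suc.IH
        cotrajectory_def less_Suc_eq)
qed

text \<open>The order formula is applied to the trajectory, itself a finite subgroup, instead of
  \<open>F\<close>. The two sequences then coincide for every \<open>n\<close>, so their
  \<open>lim\<close> values agree without any appeal to convergence.\<close>

lemma adjoint_entropy_wrt_annihilator:
  "adjoint_entropy_wrt G \<phi> (annihilator G F)
    = algebraic_entropy_wrt (dual_group G \<tau>) (dual_endo G \<phi>) F"
proof -
  have "order (cotrajectory_quotient G \<phi> (annihilator G F) n)
      = card (trajectory (dual_group G \<tau>) (dual_endo G \<phi>) F n)" for n
    using card_rcosets_annihilator[OF subgroup_trajectory finite_trajectory, of n]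
    by (simp add: cotrajectory_quotient_def order_def FactGroup_def annihilator_trajectory)
  then show ?thesis by (simp add: adjoint_entropy_wrt_def algebraic_entropy_wrt_def)
qed

end

lemma annihilator_image:
  "annihilator G ` {F. subgroup F (dual_group G \<tau>) \<and> finite F} = open_finite_index_subgroups G \<tau>"
proof (intro equalityI subsetI)
  fix N assume "N \<in> annihilator G ` {F. subgroup F (dual_group G \<tau>) \<and> finite F}"
  then obtain F where F: "subgroup F (dual_group G \<tau>)" "finite F" and N: "N = annihilator G F"
    by blast
  have "F \<subseteq> characters G \<tau>" using subgroup.subset[OF F(1)] by (simp add: carrier_dual)
  then show "N \<in> open_finite_index_subgroups G \<tau>"
    using subgroup_annihilator finite_rcosets_annihilator[OF F] openin_annihilator[OF F]
    by (simp add: N open_finite_index_subgroups_def finite_index_subgroups_def)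
qed (blast elim: open_finite_index_eq_annihilator)

end

theorem theorem1p4:
  fixes G :: "('a, 'm) monoid_scheme" and \<tau> :: "'a topology" and \<phi> :: "'a \<Rightarrow> 'a"
  assumes "compact_comm_group G \<tau>"
    and "\<phi> \<in> continuous_endo G \<tau>"
  shows "topological_adjoint_entropy G \<tau> \<phi> = algebraic_entropy (dual_group G \<tau>) (dual_endo G \<phi>)"
proof -
  interpret compact_comm_group G \<tau> by fact
  \<comment> \<open>Since annihilators exhaust the open subgroups of finite index, the supremum can
    be indexed by finite subgroups of the dual.\<close>
  have "topological_adjoint_entropy G \<tau> \<phi>
      = (SUP F\<in>{F. subgroup F (dual_group G \<tau>) \<and> finite F}.
          ereal (adjoint_entropy_wrt G \<phi> (annihilator G F)))"
    unfolding topological_adjoint_entropy_def annihilator_image[symmetric] image_image ..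
  also have "\<dots> = algebraic_entropy (dual_group G \<tau>) (dual_endo G \<phi>)"
    unfolding algebraic_entropy_def
    by (intro SUP_cong refl) (simp add: adjoint_entropy_wrt_annihilator[OF assms(2)])
  finally show ?thesis .
qed

end
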